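(* Let $A\subseteq\mathbb{N}$, let $E=\mathbb{N}\setminus(A+A)$, and put $$N_4=\{n\in\mathbb{N}: r(n)=4\},\qquad S_4(z)=\sum_{n\in N_4}z^n.$$ Define the lower Abel density $$\underline{\delta}_4=\liminf_{t\to1^-}(1-t)S_4(t).$$ If $$\underline{\delta}_4>\frac{1}{16}+3D(E),$$ then $$\limsup_{n\to\infty} r(n)>7.$$
   Context: $\mathbb{N}$ denotes the set of positive integers. For $A\subseteq\mathbb{N}$, $A+A=\{a+b: a,b\in A\}$ and $r(n)=\#\{(a,b)\in A\times A: a+b=n\}$ is the ordered representation function of $A$. For $E\subseteq\mathbb{N}$, the upper density is $D(E)=\limsup_{n\to\infty}\frac{|E\cap\{1,2,\ldots,n\}|}{n}$. The limsup of $r(n)$ is allowed to be $+\infty$. *)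

theory Defs
  imports "HOL-Analysis.Analysis" "HOL-Library.Set_Algebras"
begin

(* The positive integers are rendered as {1..} :: nat set; the sumset is the
   pointwise sum A + A from Set_Algebras. *)

definition rep_count :: "nat set \<Rightarrow> nat \<Rightarrow> nat" where
  "rep_count A n = card {(a, b). a \<in> A \<and> b \<in> A \<and> a + b = n}"

definition rep_level :: "nat set \<Rightarrow> nat \<Rightarrow> nat set" where
  "rep_level A k = {n \<in> {1..}. rep_count A n = k}"

(* The limits below are taken in ereal, so that they exist without boundedness
   conditions. The term n = 0 is 0 / 0 = 0 and does not affect the limsup. *)
definition upper_density :: "nat set \<Rightarrow> ereal" where
  "upper_density E = limsup (\<lambda>n. ereal (real (card (E \<inter> {1..n})) / real n))"

definition set_series :: "nat set \<Rightarrow> 'a::real_normed_field \<Rightarrow> 'a" where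
  "set_series B z = (\<Sum>\<^sub>\<infinity>n\<in>B. z ^ n)"

(* Only t close to 1 from below matter, where the series converges absolutely. *)
definition lower_abel_density :: "nat set \<Rightarrow> ereal" where
  "lower_abel_density B = Liminf (at_left (1::real)) (\<lambda>t. ereal ((1 - t) * set_series B t))"

end

theory Submission
  imports Defs "HOL-Real_Asymp.Real_Asymp"
begin

text \<open>
  Suppose that $r(n) \le 7$ for all large $n$, and put $f(z) = \sum_{a \in A} z^a$, so that
  $f(z)^2 = \sum_n r(n) z^n$. On the circle $|z| = \sqrt t$ with $0 < t < 1$, write
  $f^2 = g + c/(1-z)$, where $g$ has the coefficients $r(n) - c$. The mean of $|f|^2$ over the
  circle is $F = f(t)$, because the coefficients of $f$ are $0$ and $1$. The mean of $|1/(1-z)|$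
  is only logarithmic in $1/(1-t)$, so $F$ is at most the mean of $|g|$ plus a negligible term,
  and by Cauchy-Schwarz and Parseval $F^2$ is at most $\sum_n (r(n)-c)^2 t^n$ plus a negligible
  term (lemma \<open>square_sum_le_deviation\<close>). As $F^2 = \sum_n r(n) t^n$, the Abel mean of $r$ is
  asymptotically at most its Abel mean square deviation from $c$.

  Take $c = 7/2$. Then $(r-c)^2 - r$ is $1/4$ for $r = 2$ and $r = 6$, is $-15/4$ for $r = 4$
  and $49/4$ for $r = 0$. Odd values of $r(n)$ occur only at $n = 2a$ with $a \in A$, a set whose
  generating function is at most $F = O((1-t)^{-1/2})$, hence of Abel density $0$.
  Averaging gives $0 \le 1/4 + 12\,\delta(E) - 4\,\delta(N_4)$ up to $o(1)$, where $\delta$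
  is the Abel mean at $t$ (lemma \<open>abel_level_inequality\<close>). Since Abel means are asymptotically
  at most the upper density (lemma \<open>abel_mean_le_upper_density\<close>), the lower Abel density of
  $N_4$ is at most $1/16 + 3 D(E)$. The choice $c = 7/2$ is the one that makes the constant
  $1/16$ least: if $E$ is negligible and $x$ is the density of $r = 6$ minus that of
  $r = 2$, the mean of $r$ is $4 + 2x$, and the extremal case is $x = -1/4$.
\<close>

section \<open>Parseval's identity on a circle\<close>

lemma cis_has_integral:
  fixes k :: int
  shows "((\<lambda>x. cis (of_int k * x)) has_integral (if k = 0 then 2 * pi else 0)) {0..2 * pi}"
proof (cases "k = 0")
  case True
  then show ?thesis
    using has_integral_const_real[of "1::complex" 0 "2 * pi"] by (simp add: scaleR_conv_of_real)
next
  case False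
  let ?F = "\<lambda>x::real. exp (\<i> * of_int k * of_real x) / (\<i> * of_int k)"
  have "(?F has_vector_derivative exp (\<i> * of_int k * of_real x)) (at x within {0..2 * pi})" for x
    using False
    by (intro has_vector_derivative_real_field) (auto intro!: derivative_eq_intros)
  then have "((\<lambda>x::real. exp (\<i> * of_int k * of_real x)) has_integral ?F (2 * pi) - ?F 0) {0..2 * pi}"
    by (intro fundamental_theorem_of_calculus) auto
  moreover have "exp (\<i> * of_int k * of_real (2 * pi)) = 1"
    using exp_eq_1[of "\<i> * of_int k * of_real (2 * pi)"] by auto
  moreover have "exp (\<i> * of_int k * of_real x) = cis (of_int k * x)" for x
    by (simp add: cis_conv_exp mult_ac)
  ultimately show ?thesis using False by simp
qed

lemma norm_mult_cis [simp]: "norm (c * cis x) = norm c"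
  by (simp add: norm_mult)

text \<open>
  Partial sums satisfy the identity by orthogonality of the characters. They are bounded by
  \<open>\<Sum>n. norm (c n)\<close>, so dominated convergence carries it over to the limit.
\<close>
lemma parseval_circle:
  fixes c :: "nat \<Rightarrow> complex"
  assumes summable: "summable (\<lambda>n. norm (c n))"
  shows "summable (\<lambda>n. (norm (c n))\<^sup>2)"
    and "((\<lambda>x. (norm (\<Sum>n. c n * cis (real n * x)))\<^sup>2)
      has_integral 2 * pi * (\<Sum>n. (norm (c n))\<^sup>2)) {0..2 * pi}"
proof -
  define P where "P = (\<lambda>N x. \<Sum>n<N. c n * cis (real n * x))"
  define g where "g = (\<lambda>x. (norm (\<Sum>n. c n * cis (real n * x)))\<^sup>2)"
  define M where "M = (\<Sum>n. norm (c n))"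
  have P_integral: "((\<lambda>x. (norm (P N x))\<^sup>2) has_integral 2 * pi * (\<Sum>n<N. (norm (c n))\<^sup>2)) {0..2 * pi}" for N
  proof -
    have "complex_of_real ((norm (P N x))\<^sup>2)
        = (\<Sum>m<N. \<Sum>n<N. c m * cnj (c n) * cis (of_int (int m - int n) * x))" for x
    proof -
      have "cis (of_int (int m - int n) * x) = cis (real m * x) * cnj (cis (real n * x))" for m n
        by (simp add: cis_cnj cis_mult left_diff_distrib)
      then show ?thesis
        unfolding complex_norm_square P_def cnj_sum sum_product
        by (intro sum.cong refl) simp
    qed
    moreover have "((\<lambda>x. \<Sum>m<N. \<Sum>n<N. c m * cnj (c n) * cis (of_int (int m - int n) * x))
        has_integral (\<Sum>m<N. \<Sum>n<N. c m * cnj (c n) * (if int m - int n = 0 then 2 * pi else 0))) {0..2 * pi}"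
      by (intro has_integral_sum has_integral_mult_right cis_has_integral) auto
    moreover have "(\<Sum>m<N. \<Sum>n<N. c m * cnj (c n) * (if int m - int n = 0 then 2 * pi else 0))
        = complex_of_real (2 * pi * (\<Sum>n<N. (norm (c n))\<^sup>2))"
    proof -
      have "(\<Sum>n<N. c m * cnj (c n) * (if int m - int n = 0 then 2 * pi else 0))
          = (if m < N then complex_of_real (2 * pi * (norm (c m))\<^sup>2) else 0)" for m
      proof -
        have "(\<Sum>n<N. c m * cnj (c n) * (if int m - int n = 0 then 2 * pi else 0))
          = (\<Sum>n<N. if n = m then c m * cnj (c m) * of_real (2 * pi) else 0)"
          by (intro sum.cong) auto
        then show ?thesis
          by (simp add: complex_norm_square del: of_real_power)
      qed
      then show ?thesis by (simp add: sum_distrib_left)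
    qed
    ultimately have "((\<lambda>x. complex_of_real ((norm (P N x))\<^sup>2))
        has_integral complex_of_real (2 * pi * (\<Sum>n<N. (norm (c n))\<^sup>2))) {0..2 * pi}"
      by simp
    from has_integral_Re[OF this] show ?thesis by simp
  qed
  have sm: "summable (\<lambda>n. c n * cis (real n * x))" for x
    by (rule summable_norm_cancel) (use summable in simp)
  have "norm ((norm (P N x))\<^sup>2) \<le> M\<^sup>2" for N x
  proof -
    have "norm (P N x) \<le> (\<Sum>n<N. norm (c n))"
      unfolding P_def by (rule order_trans[OF norm_sum]) simp
    also have "\<dots> \<le> M"
      unfolding M_def by (rule sum_le_suminf[OF summable]) auto
    finally show ?thesis by (simp add: power_mono)
  qed
  moreover have "(\<lambda>N. (norm (P N x))\<^sup>2) \<longlonglongrightarrow> g x" for x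
    unfolding P_def g_def by (intro tendsto_intros summable_LIMSEQ sm)
  ultimately have g: "g integrable_on {0..2 * pi}"
    "(\<lambda>N. integral {0..2 * pi} (\<lambda>x. (norm (P N x))\<^sup>2)) \<longlonglongrightarrow> integral {0..2 * pi} g"
    using dominated_convergence[of "\<lambda>N x. (norm (P N x))\<^sup>2" "{0..2 * pi}" "\<lambda>_. M\<^sup>2" g]
      P_integral by (auto simp: has_integral_iff)
  then have "(\<lambda>N. 2 * pi * (\<Sum>n<N. (norm (c n))\<^sup>2)) \<longlonglongrightarrow> integral {0..2 * pi} g"
    using P_integral by (simp add: has_integral_iff)
  then have "(\<lambda>N. 1 / (2 * pi) * (2 * pi * (\<Sum>n<N. (norm (c n))\<^sup>2)))
      \<longlonglongrightarrow> 1 / (2 * pi) * integral {0..2 * pi} g"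
    by (intro tendsto_intros)
  then have "(\<lambda>n. (norm (c n))\<^sup>2) sums (1 / (2 * pi) * integral {0..2 * pi} g)"
    unfolding sums_def by simp
  then show "summable (\<lambda>n. (norm (c n))\<^sup>2)"
    and "(g has_integral 2 * pi * (\<Sum>n. (norm (c n))\<^sup>2)) {0..2 * pi}"
    using g(1) by (auto simp: sums_iff has_integral_iff)
qed

section \<open>The pole at 1 has a small mean\<close>

lemma inverse_sqrt_coeff_bound:
  "((- 1 / 2 :: real) gchoose n)\<^sup>2 \<le> 1 / (real n + 1)"
proof (induction n)
  case (Suc n)
  let ?b = "\<lambda>n. (- 1 / 2 :: real) gchoose n"
  have "?b (Suc n) = - ((2 * real n + 1) / (2 * real n + 2)) * ?b n"
    using gbinomial_mult_1[of "- 1 / 2 :: real" n] by (simp add: field_simps)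
  then have "(?b (Suc n))\<^sup>2 = ((2 * real n + 1) / (2 * real n + 2))\<^sup>2 * (?b n)\<^sup>2"
    by (simp only: power_mult_distrib power2_minus)
  also have "\<dots> \<le> ((2 * real n + 1) / (2 * real n + 2))\<^sup>2 * (1 / (real n + 1))"
    using Suc by (intro mult_left_mono) auto
  also have "\<dots> \<le> 1 / (real (Suc n) + 1)"
    by (simp add: divide_simps power2_eq_square) (simp add: algebra_simps)
  finally show ?case .
qed simp

text \<open>
  The mean of \<open>|1 / (1 - z)|\<close> over the circle \<open>|z| = sqrt t\<close> is accessible to Parseval because
  \<open>1 / (1 - z)\<close> is the square of \<open>(1 - z) powr (- 1 / 2)\<close>. The squared binomial coefficients are
  \<open>O(1 / n)\<close>, so this mean grows only logarithmically. Cauchy-Schwarz applied to \<open>1 / (1 - z)\<close>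
  itself would give \<open>(1 - t) powr (- 1 / 2)\<close>, which is of the same order as the main term.
\<close>
lemma inverse_sqrt_series:
  fixes t :: real
  assumes t: "0 < t" "t < 1"
  obtains b :: "nat \<Rightarrow> complex" where
    "summable (\<lambda>n. norm (b n))"
    "\<And>x. (norm (\<Sum>n. b n * cis (real n * x)))\<^sup>2 = norm (1 / (1 - of_real (sqrt t) * cis x))"
    "(\<Sum>n. (norm (b n))\<^sup>2) \<le> 1 - ln (1 - t)"
proof -
  define b where "b = (\<lambda>n. ((- 1 / 2 :: complex) gchoose n) * (- of_real (sqrt t)) ^ n)"
  have s: "0 < sqrt t" "sqrt t < 1" using t by auto
  have gch: "((- 1 / 2 :: complex) gchoose n) = of_real ((- 1 / 2 :: real) gchoose n)" for n
    by (simp add: gbinomial_prod_rev)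
  have normb: "norm (b n) = \<bar>(- 1 / 2 :: real) gchoose n\<bar> * sqrt t ^ n" for n
    unfolding b_def gch using s by (simp add: norm_mult norm_power)
  have norm2: "(norm (b n))\<^sup>2 \<le> t ^ n / (real n + 1)" for n
  proof -
    have "(sqrt t ^ n)\<^sup>2 = t ^ n"
      using t by (metis power_even_eq power_mult mult.commute real_sqrt_pow2 less_imp_le)
    then show ?thesis unfolding normb power_mult_distrib power2_abs
      using mult_right_mono[OF inverse_sqrt_coeff_bound[of n], of "t ^ n"] t by simp
  qed
  have 1: "summable (\<lambda>n. norm (b n))"
  proof (rule summable_comparison_test')
    show "summable (\<lambda>n. sqrt t ^ n)" using s by (simp add: summable_geometric)
    have "((- 1 / 2 :: real) gchoose n)\<^sup>2 \<le> 1" for n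
      using inverse_sqrt_coeff_bound[of n] by (rule order_trans) simp
    then have "\<bar>(- 1 / 2 :: real) gchoose n\<bar> \<le> 1" for n
      by (metis abs_square_le_1)
    then show "norm (norm (b n)) \<le> sqrt t ^ n" for n
      unfolding normb using s by (simp add: mult_left_le_one_le)
  qed
  moreover have "(norm (\<Sum>n. b n * cis (real n * x)))\<^sup>2 = norm (1 / (1 - of_real (sqrt t) * cis x))" for x
  proof -
    define z where "z = - (of_real (sqrt t) * cis x)"
    have "norm z < 1" using s by (simp add: z_def norm_mult)
    from gen_binomial_complex[OF this, of "- 1 / 2"]
    have "(\<lambda>n. b n * cis (real n * x)) sums ((1 + z) powr (- 1 / 2))"
      by (simp add: b_def z_def power_mult_distrib Complex.DeMoivre power_minus' mult_ac)
    then have "norm (\<Sum>n. b n * cis (real n * x)) = norm (1 + z) powr (- 1 / 2)"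
      by (simp add: sums_iff norm_powr_real_powr')
    moreover have "1 + z \<noteq> 0" using \<open>norm z < 1\<close>
      by (metis add_eq_0_iff norm_minus_cancel norm_one order_less_irrefl)
    ultimately have "(norm (\<Sum>n. b n * cis (real n * x)))\<^sup>2 = 1 / norm (1 + z)"
      by (simp add: power2_eq_square powr_minus_divide flip: powr_add)
    then show ?thesis by (simp add: z_def norm_divide)
  qed
  moreover have "(\<Sum>n. (norm (b n))\<^sup>2) \<le> 1 - ln (1 - t)"
  proof -
    have "(\<lambda>n. t ^ n / real n) sums (- ln (1 - t))"
      using sums_minus[OF ln_series'[of "- t"]] t by simp
    moreover have "(\<lambda>n. if n = 0 then 1 else 0) sums (1::real)"
      using sums_single[of 0 "\<lambda>_. 1::real"] by simp
    ultimately have S: "(\<lambda>n. (if n = 0 then 1 else 0) + t ^ n / real n) sums (1 + - ln (1 - t))"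
      by (intro sums_add)
    have "(norm (b n))\<^sup>2 \<le> (if n = 0 then 1 else 0) + t ^ n / real n" for n
    proof -
      have "t ^ n / (real n + 1) \<le> (if n = 0 then 1 else 0) + t ^ n / real n"
        using t by (auto intro!: divide_left_mono)
      with norm2[of n] show ?thesis by linarith
    qed
    then have "(\<Sum>n. (norm (b n))\<^sup>2) \<le> (\<Sum>n. (if n = 0 then 1 else 0) + t ^ n / real n)"
      by (intro suminf_le parseval_circle(1) 1 sums_summable[OF S]) 
    then show ?thesis using S by (simp add: sums_iff)
  qed
  ultimately show ?thesis by (rule that)
qed

section \<open>Squares of power series with coefficients 0 and 1\<close>

text \<open>
  Integrate \<open>|f|\<^sup>2 \<le> |g| + c |1 / (1 - z)|\<close> over the circle \<open>|z| = sqrt t\<close>, where \<open>f\<close> has the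
  coefficients \<open>a\<close> and \<open>g = f\<^sup>2 - c / (1 - z)\<close> has the coefficients \<open>r - c\<close>. In place of
  Cauchy-Schwarz the proof uses \<open>|g| \<le> |g|\<^sup>2 / (2 F) + F / 2\<close>: since \<open>F\<close> is the quantity being
  bounded, this weight absorbs half of the left-hand side and loses nothing.
\<close>
lemma square_sum_le_deviation:
  fixes a r :: "nat \<Rightarrow> real" and c t :: real
  assumes t: "0 < t" "t < 1" and c: "c \<ge> 0"
    and a: "\<And>n. a n \<in> {0, 1}"
    and r: "\<And>n. r n = (\<Sum>i\<le>n. a i * a (n - i))"
  defines "F \<equiv> (\<Sum>n. a n * t ^ n)"
  shows "summable (\<lambda>n. (r n - c)\<^sup>2 * t ^ n)"
    and "F\<^sup>2 \<le> (\<Sum>n. (r n - c)\<^sup>2 * t ^ n) + 2 * c * (1 - ln (1 - t)) * F"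
proof -
  define \<rho> where "\<rho> = sqrt t"
  have \<rho>: "0 < \<rho>" "\<rho> < 1" "\<And>n. (\<rho> ^ n)\<^sup>2 = t ^ n"
    using t by (auto simp: \<rho>_def) (metis power_even_eq power_mult mult.commute real_sqrt_pow2 less_imp_le)
  define f where "f = (\<lambda>x. \<Sum>n. complex_of_real (a n * \<rho> ^ n) * cis (real n * x))"
  define g where "g = (\<lambda>x. \<Sum>n. complex_of_real ((r n - c) * \<rho> ^ n) * cis (real n * x))"
  have geo: "summable (\<lambda>n. \<rho> ^ n)" using \<rho> by (simp add: summable_geometric)
  have a01: "0 \<le> a n" "a n \<le> 1" "(a n)\<^sup>2 = a n" for n using a[of n] by auto
  have asum: "summable (\<lambda>n. a n * \<rho> ^ n)"
    by (rule summable_comparison_test'[OF geo, of 0])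
       (use a01 \<rho> in \<open>auto simp: abs_mult mult_left_le_one_le\<close>)
  have asumn: "summable (\<lambda>n. norm (a n * \<rho> ^ n))" using asum a01 \<rho> by simp
  have conv: "(\<Sum>i\<le>n. (a i * \<rho> ^ i) * (a (n - i) * \<rho> ^ (n - i))) = r n * \<rho> ^ n" for n
    unfolding r sum_distrib_right
    by (intro sum.cong refl) (simp add: mult_ac flip: power_add)
  have rsum: "summable (\<lambda>n. r n * \<rho> ^ n)"
    using summable_Cauchy_product[OF asumn asumn] by (simp add: conv)
  have r0: "r n \<ge> 0" for n unfolding r by (intro sum_nonneg mult_nonneg_nonneg a01)
  have gsum: "summable (\<lambda>n. norm ((r n - c) * \<rho> ^ n))"
  proof (rule summable_comparison_test')
    show "summable (\<lambda>n. r n * \<rho> ^ n + c * \<rho> ^ n)"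
      by (intro summable_add rsum summable_mult geo)
    show "norm (norm ((r n - c) * \<rho> ^ n)) \<le> r n * \<rho> ^ n + c * \<rho> ^ n" for n
      using r0[of n] c \<rho> by (simp add: abs_mult mult_right_mono flip: distrib_right)
  qed
  obtain b :: "nat \<Rightarrow> complex" where b: "summable (\<lambda>n. norm (b n))"
    "\<And>x. (norm (\<Sum>n. b n * cis (real n * x)))\<^sup>2 = norm (1 / (1 - of_real \<rho> * cis x))"
    "(\<Sum>n. (norm (b n))\<^sup>2) \<le> 1 - ln (1 - t)"
    using inverse_sqrt_series[OF t] unfolding \<rho>_def by blast
  define G where "G = (\<Sum>n. (r n - c)\<^sup>2 * t ^ n)"
  define H where "H = (\<Sum>n. (norm (b n))\<^sup>2)"
  have parseval_f: "((\<lambda>x. (norm (f x))\<^sup>2) has_integral 2 * pi * F) {0..2 * pi}"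
    using parseval_circle(2)[of "\<lambda>n. complex_of_real (a n * \<rho> ^ n)"] asumn
    by (simp only: f_def F_def norm_of_real real_norm_def power2_abs power_mult_distrib \<rho>(3) a01(3))
  have parseval_g: "((\<lambda>x. (norm (g x))\<^sup>2) has_integral 2 * pi * G) {0..2 * pi}"
    and G: "summable (\<lambda>n. (r n - c)\<^sup>2 * t ^ n)"
    using parseval_circle[of "\<lambda>n. complex_of_real ((r n - c) * \<rho> ^ n)"] gsum
    by (simp_all only: g_def G_def norm_of_real real_norm_def power2_abs power_mult_distrib \<rho>(3))
  note parseval_b = parseval_circle(2)[OF b(1), folded H_def]
  show "summable (\<lambda>n. (r n - c)\<^sup>2 * t ^ n)" by fact
  have G0: "G \<ge> 0" unfolding G_def using t by (intro suminf_nonneg G) auto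
  have fg: "(f x)\<^sup>2 = g x + of_real c * (1 / (1 - of_real \<rho> * cis x))" for x
  proof -
    define z where "z = of_real \<rho> * cis x"
    have nz: "norm z < 1" using \<rho> by (simp add: z_def norm_mult)
    have summand: "complex_of_real (u * \<rho> ^ n) * cis (real n * x) = of_real u * z ^ n" for u n
      by (simp add: z_def power_mult_distrib Complex.DeMoivre mult_ac)
    have nterm: "norm (of_real u * z ^ n) = norm (u * \<rho> ^ n)" for u n
      using \<rho> by (simp add: z_def norm_mult norm_power abs_mult)
    have "(\<lambda>n. \<Sum>i\<le>n. (complex_of_real (a i) * z ^ i) * (of_real (a (n - i)) * z ^ (n - i)))
        sums (f x * f x)"
      unfolding f_def summand by (intro Cauchy_product_sums) (simp_all only: nterm asumn)
    moreover have "(\<Sum>i\<le>n. (complex_of_real (a i) * z ^ i) * (of_real (a (n - i)) * z ^ (n - i)))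
        = of_real (r n) * z ^ n" for n
      unfolding r of_real_sum sum_distrib_right
      by (intro sum.cong refl) (simp add: mult_ac flip: power_add)
    ultimately have "(\<lambda>n. of_real (r n) * z ^ n) sums (f x * f x)" by simp
    moreover have "(\<lambda>n. complex_of_real c * z ^ n) sums (of_real c * (1 / (1 - z)))"
      by (intro sums_mult geometric_sums nz)
    ultimately have "(\<lambda>n. of_real (r n) * z ^ n - complex_of_real c * z ^ n)
        sums (f x * f x - of_real c * (1 / (1 - z)))"
      by (rule sums_diff)
    then have "g x = f x * f x - of_real c * (1 / (1 - z))"
      unfolding g_def summand by (simp add: sums_iff algebra_simps)
    then show ?thesis by (simp add: z_def power2_eq_square)
  qed
  show "F\<^sup>2 \<le> (\<Sum>n. (r n - c)\<^sup>2 * t ^ n) + 2 * c * (1 - ln (1 - t)) * F"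
  proof (cases "F = 0")
    case True
    then show ?thesis using G0 by (simp add: G_def)
  next
    case False
    have "F \<ge> 0"
    proof -
      have "0 \<le> 2 * pi * F"
        by (rule has_integral_nonneg[OF parseval_f]) simp
      then show ?thesis using pi_gt_zero by (simp only: mult.assoc zero_le_mult_iff) auto
    qed
    with False have F: "F > 0" by simp
    have "(norm (f x))\<^sup>2 \<le> (norm (g x))\<^sup>2 * (1 / (2 * F)) + F / 2
        + (norm (\<Sum>n. b n * cis (real n * x)))\<^sup>2 * c" for x
    proof -
      have "(norm (f x))\<^sup>2 \<le> norm (g x) + norm (of_real c * (1 / (1 - of_real \<rho> * cis x)))"
        unfolding norm_power[symmetric] fg by (rule norm_triangle_ineq)
      moreover have "norm (of_real c * (1 / (1 - of_real \<rho> * cis x)))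
          = (norm (\<Sum>n. b n * cis (real n * x)))\<^sup>2 * c"
        unfolding b(2) norm_mult using c by simp
      moreover have "norm (g x) \<le> (norm (g x))\<^sup>2 * (1 / (2 * F)) + F / 2"
      proof -
        have "0 \<le> (norm (g x) - F)\<^sup>2" by simp
        then show ?thesis using F by (simp add: field_simps power2_eq_square)
      qed
      ultimately show ?thesis by linarith
    qed
    moreover have "((\<lambda>x. (norm (g x))\<^sup>2 * (1 / (2 * F)) + F / 2
        + (norm (\<Sum>n. b n * cis (real n * x)))\<^sup>2 * c)
        has_integral 2 * pi * G * (1 / (2 * F)) + 2 * pi * (F / 2) + 2 * pi * H * c) {0..2 * pi}"
      using has_integral_const_real[of "F / 2" 0 "2 * pi"]
      by (intro has_integral_add has_integral_mult_left parseval_g parseval_b) simp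
    ultimately have "2 * pi * F \<le> 2 * pi * G * (1 / (2 * F)) + 2 * pi * (F / 2) + 2 * pi * H * c"
      using has_integral_le[OF parseval_f] by blast
    also have "\<dots> = 2 * pi * (G / (2 * F) + F / 2 + H * c)" by (simp add: algebra_simps)
    finally have "F \<le> G / (2 * F) + F / 2 + H * c"
      by (subst (asm) mult_le_cancel_left_pos) auto
    then have "F\<^sup>2 \<le> G + 2 * c * H * F" using F by (simp add: field_simps power2_eq_square)
    moreover have "2 * c * H * F \<le> 2 * c * (1 - ln (1 - t)) * F"
      using b(3) c F by (intro mult_right_mono mult_left_mono) (auto simp: H_def)
    ultimately show ?thesis unfolding G_def by linarith
  qed
qed

section \<open>The representation function\<close>

lemma rep_count_pairs_finite: "finite {(a, b). a \<in> A \<and> b \<in> A \<and> a + b = (n::nat)}"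
  by (rule finite_subset[of _ "{..n} \<times> {..n}"]) auto

lemma rep_count_convolution:
  "real (rep_count A n) = (\<Sum>i\<le>n. of_bool (i \<in> A) * of_bool (n - i \<in> A))"
proof -
  have "bij_betw (\<lambda>i. (i, n - i)) {i \<in> {..n}. i \<in> A \<and> n - i \<in> A}
      {(a, b). a \<in> A \<and> b \<in> A \<and> a + b = n}"
    by (rule bij_betwI[where g = fst]) auto
  then have "rep_count A n = card {i \<in> {..n}. i \<in> A \<and> n - i \<in> A}"
    unfolding rep_count_def by (simp add: bij_betw_same_card)
  also have "real \<dots> = (\<Sum>i\<le>n. of_bool (i \<in> A \<and> n - i \<in> A))"
    by (simp add: Int_def)
  finally show ?thesis by (simp add: of_bool_conj)
qed

lemma rep_count_pos_iff: "rep_count A n > 0 \<longleftrightarrow> n \<in> A + A"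
  unfolding rep_count_def card_gt_0_iff using rep_count_pairs_finite[of A n]
  by (auto simp: set_plus_def)

text \<open>
  Swapping the two summands pairs off all representations except \<open>n = a + a\<close>.
\<close>
lemma odd_rep_count_imp_double:
  assumes "odd (rep_count A n)"
  shows "even n \<and> n div 2 \<in> A"
proof (rule ccontr)
  assume *: "\<not> ?thesis"
  let ?P = "\<lambda>R. {(a, b). a \<in> A \<and> b \<in> A \<and> a + b = n \<and> R a b}"
  have "{(a, b). a \<in> A \<and> b \<in> A \<and> a + b = n} = ?P (<) \<union> ?P (>)"
  proof -
    have "a \<noteq> b" if "a \<in> A" "a + b = n" for a b
      using * that by auto
    then show ?thesis by (auto simp: neq_iff)
  qed
  moreover have "finite (?P (<))" "finite (?P (>))"
    by (rule finite_subset[OF _ rep_count_pairs_finite[of A n]]; auto)+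
  moreover have "?P (<) \<inter> ?P (>) = {}" by auto
  ultimately have "rep_count A n = card (?P (<)) + card (?P (>))"
    unfolding rep_count_def by (simp add: card_Un_disjoint)
  moreover have "bij_betw prod.swap (?P (<)) (?P (>))"
    by (rule bij_betwI[where g = prod.swap]) auto
  then have "card (?P (<)) = card (?P (>))" by (rule bij_betw_same_card)
  ultimately show False using assms by simp
qed

section \<open>Abel means\<close>

lemma summable_bounded_power_series:
  fixes u :: "nat \<Rightarrow> real" and t :: real
  assumes "0 \<le> t" "t < 1" and "\<And>n. \<bar>u n\<bar> \<le> C"
  shows "summable (\<lambda>n. u n * t ^ n)"
proof (rule summable_comparison_test')
  show "summable (\<lambda>n. C * t ^ n)" using assms by (simp add: summable_geometric summable_mult)
  show "norm (u n * t ^ n) \<le> C * t ^ n" for n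
    using assms by (simp add: abs_mult mult_right_mono)
qed

lemma set_series_eq_suminf:
  fixes t :: real
  assumes "0 \<le> t" "t < 1"
  shows "set_series B t = (\<Sum>n. of_bool (n \<in> B) * t ^ n)"
proof -
  have s: "summable (\<lambda>n. of_bool (n \<in> B) * t ^ n)"
    by (rule summable_bounded_power_series[where C = 1]) (use assms in auto)
  have "set_series B t = (\<Sum>\<^sub>\<infinity>n\<in>UNIV. of_bool (n \<in> B) * t ^ n)"
    unfolding set_series_def by (rule infsum_cong_neutral) auto
  also have "\<dots> = (\<Sum>n. of_bool (n \<in> B) * t ^ n)"
    using s assms by (intro infsumI norm_summable_imp_has_sum summable_sums) (auto simp: abs_mult)
  finally show ?thesis .
qed

text \<open>
  Summation by parts, in the form of the Cauchy product with the geometric series, turns the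
  series of \<open>E\<close> into that of its counting function, which is eventually at most \<open>d * n\<close>.
\<close>
lemma abel_mean_le_upper_density:
  fixes E :: "nat set" and d :: real
  assumes E: "0 \<notin> E" and d: "upper_density E < ereal d"
  obtains N :: real where "\<And>t. 0 < t \<Longrightarrow> t < 1 \<Longrightarrow> (1 - t) * (\<Sum>n. of_bool (n \<in> E) * t ^ n) \<le> d + N * (1 - t)"
proof -
  define e where "e = (\<lambda>n. real (card (E \<inter> {1..n})))"
  have "eventually (\<lambda>n. ereal (e n / real n) < ereal d) sequentially"
    using d unfolding upper_density_def e_def by (rule Limsup_lessD)
  then obtain N where N: "\<And>n. n \<ge> N \<Longrightarrow> e n / real n < d"
    by (auto simp: eventually_sequentially)
  have "0 \<le> e N / real N" by (simp add: e_def)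
  with N[of N] have d0: "d > 0" by simp
  have e_le_n: "e n \<le> real n" for n
    unfolding e_def using card_mono[of "{1..n}" "E \<inter> {1..n}"] by simp
  have e_le: "e n \<le> d * real (Suc n) + real N" for n
  proof (cases "n \<ge> N \<and> n > 0")
    case True
    then have "e n \<le> d * real n" using N[of n] by (simp add: field_simps)
    also have "\<dots> \<le> d * real (Suc n)" using d0 by simp
    finally show ?thesis by simp
  next
    case False
    then have "e n \<le> real N" using e_le_n[of n] by (cases "n = 0") auto
    then show ?thesis using d0 by (simp add: add_increasing)
  qed
  have "(1 - t) * (\<Sum>n. of_bool (n \<in> E) * t ^ n) \<le> d + real N * (1 - t)"
    if t: "0 < t" "t < 1" for t :: real
  proof -
    let ?S = "\<Sum>n. of_bool (n \<in> E) * t ^ n"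
    have s: "summable (\<lambda>n. norm (of_bool (n \<in> E) * t ^ n))"
      using summable_bounded_power_series[of t "\<lambda>n. of_bool (n \<in> E)" 1] t by (simp add: abs_mult)
    have g: "summable (\<lambda>n. norm (t ^ n))" using t by (simp add: summable_geometric)
    have "(\<Sum>i\<le>n. of_bool (i \<in> E) * t ^ i * t ^ (n - i)) = e n * t ^ n" for n
    proof -
      have "(\<Sum>i\<le>n. of_bool (i \<in> E) * t ^ i * t ^ (n - i)) = (\<Sum>i\<le>n. of_bool (i \<in> E)) * t ^ n"
        unfolding sum_distrib_right by (intro sum.cong refl) (simp add: mult_ac flip: power_add)
      also have "(\<Sum>i\<le>n. of_bool (i \<in> E)) = real (card ({..n} \<inter> E))"
        by (simp add: Int_def)
      also have "{..n} \<inter> E = E \<inter> {1..n}" using E by (auto simp: Suc_le_eq intro: gr0I)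
      finally show ?thesis by (simp add: e_def)
    qed
    with Cauchy_product_sums[OF s g] have S: "(\<lambda>n. e n * t ^ n) sums (?S * (1 / (1 - t)))"
      using t by (simp add: suminf_geometric)
    have "(\<lambda>n. d * (real (Suc n) * t ^ n) + real N * t ^ n) sums (d * (1 / (1 - t)\<^sup>2) + real N * (1 / (1 - t)))"
      using t by (intro sums_add sums_mult geometric_sums geometric_deriv_sums) auto
    then have "?S * (1 / (1 - t)) \<le> d * (1 / (1 - t)\<^sup>2) + real N * (1 / (1 - t))"
    proof (rule sums_le[OF _ S, rotated])
      show "e n * t ^ n \<le> d * (real (Suc n) * t ^ n) + real N * t ^ n" for n
        using mult_right_mono[OF e_le[of n], of "t ^ n"] t by (simp add: algebra_simps)
    qed
    then have "(1 - t)\<^sup>2 * (?S * (1 / (1 - t))) \<le> (1 - t)\<^sup>2 * (d * (1 / (1 - t)\<^sup>2) + real N * (1 / (1 - t)))"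
      by (rule mult_left_mono) simp
    moreover have "u\<^sup>2 * (s * (1 / u)) = u * s"
      "u\<^sup>2 * (d * (1 / u\<^sup>2) + s * (1 / u)) = d + s * u" if "u \<noteq> 0" for u s :: real
      using that by (simp_all add: power2_eq_square field_simps)
    ultimately show ?thesis using t by simp
  qed
  then show ?thesis by (rule that)
qed

lemma upper_density_bounds: "0 \<le> upper_density E" "upper_density E \<le> 1"
proof -
  have "eventually (\<lambda>n. ereal (real (card (E \<inter> {1..n})) / real n) \<le> 1) sequentially"
  proof (intro always_eventually allI)
    fix n :: nat
    have "card (E \<inter> {1..n}) \<le> n"
      using card_mono[of "{1..n}" "E \<inter> {1..n}"] by simp
    then show "ereal (real (card (E \<inter> {1..n})) / real n) \<le> 1"
      by (cases "n = 0") (auto simp: divide_le_eq)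
  qed
  then show "upper_density E \<le> 1" unfolding upper_density_def by (rule Limsup_bounded)
  show "0 \<le> upper_density E" unfolding upper_density_def
    by (rule le_Limsup) (auto intro!: always_eventually)
qed

text \<open>
  The pointwise form of the final estimate. The coefficient 6 of the odd values is a convenient
  upper bound: these values form a set of Abel density 0.
\<close>
lemma deviation_minus_count_le:
  assumes "r \<le> (7::nat)"
  shows "(real r - 7 / 2)\<^sup>2 - real r
    \<le> 1 / 4 + 12 * of_bool (r = 0) - 4 * of_bool (r = 4) + 6 * of_bool (odd r)"
proof -
  from assms have "r \<in> {0, 1, 2, 3, 4, 5, 6, 7}" by auto
  then show ?thesis by (auto simp: power2_eq_square)
qed

lemma error_tendsto_0:
  fixes K M :: real
  shows "((\<lambda>t. (K * (1 - t) + M * sqrt (1 - t) * (6 + 7 * (1 - ln (1 - t)))) / 4) \<longlongrightarrow> 0) (at_left 1)"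
  by real_asymp

section \<open>The Abel density of the level set\<close>

text \<open>
  Sum the pointwise bound of \<open>deviation_minus_count_le\<close> with weights \<open>t ^ n\<close> and combine it with
  \<open>square_sum_le_deviation\<close> for \<open>c = 7 / 2\<close>. The constant \<open>K\<close> pays for the indices below \<open>N\<close>;
  the terms with \<open>M\<close> come from \<open>F \<le> M / sqrt (1 - t)\<close>, used both for the odd values of \<open>r\<close>
  and for the pole at 1.
\<close>
lemma abel_level_inequality:
  fixes A :: "nat set" and N :: nat
  assumes N: "N > 0" and r7: "\<And>n. n \<ge> N \<Longrightarrow> rep_count A n \<le> 7"
  obtains K M :: real where
    "\<And>t. 0 < t \<Longrightarrow> t < 1 \<Longrightarrow>
      (1 - t) * (\<Sum>n. of_bool (n \<in> rep_level A 4) * t ^ n)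
      \<le> 1 / 16 + 3 * ((1 - t) * (\<Sum>n. of_bool (n \<in> {1..} - (A + A)) * t ^ n))
        + (K * (1 - t) + M * sqrt (1 - t) * (6 + 7 * (1 - ln (1 - t)))) / 4"
proof -
  define r where "r = (\<lambda>n. real (rep_count A n))"
  define k where "k = (\<lambda>n. if n \<in> {..<N} then (r n - 7 / 2)\<^sup>2 + 4 else 0)"
  define l where "l = (\<lambda>n. if n \<in> {..<N} then r n else 0)"
  define K where "K = (\<Sum>n<N. (r n - 7 / 2)\<^sup>2 + 4)"
  define L where "L = (\<Sum>n<N. r n)"
  have k: "k sums K" and l: "l sums L"
    unfolding k_def K_def l_def L_def by (rule sums_If_finite_set; simp)+
  have L0: "L \<ge> 0" unfolding L_def r_def by (simp add: sum_nonneg)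
  have "(1 - t) * (\<Sum>n. of_bool (n \<in> rep_level A 4) * t ^ n)
      \<le> 1 / 16 + 3 * ((1 - t) * (\<Sum>n. of_bool (n \<in> {1..} - (A + A)) * t ^ n))
        + (K * (1 - t) + sqrt (7 + L) * sqrt (1 - t) * (6 + 7 * (1 - ln (1 - t)))) / 4"
    if t: "0 < t" "t < 1" for t :: real
  proof -
    let ?ind = "\<lambda>B n. of_bool (n \<in> B) :: real"
    define F where "F = (\<Sum>n. ?ind A n * t ^ n)"
    define S4 where "S4 = (\<Sum>n. ?ind (rep_level A 4) n * t ^ n)"
    define SE where "SE = (\<Sum>n. ?ind ({1..} - (A + A)) n * t ^ n)"
    define G where "G = (\<Sum>n. (r n - 7 / 2)\<^sup>2 * t ^ n)"
    define H where "H = 1 - ln (1 - t)"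
    have H: "H \<ge> 1" using t by (simp add: H_def)
    have ind_sums: "(\<lambda>n. ?ind B n * t ^ n) sums (\<Sum>n. ?ind B n * t ^ n)" for B
      by (intro summable_sums summable_bounded_power_series[where C = 1]) (use t in auto)
    note F = ind_sums[of A, folded F_def]
    have F0: "F \<ge> 0"
      using t unfolding F_def by (intro suminf_nonneg sums_summable[OF F]) auto
    have r_conv: "r n = (\<Sum>i\<le>n. ?ind A i * ?ind A (n - i))" for n
      unfolding r_def by (rule rep_count_convolution)
    have deviation: "(\<lambda>n. (r n - 7 / 2)\<^sup>2 * t ^ n) sums G"
      "F\<^sup>2 \<le> G + 7 * H * F"
      using square_sum_le_deviation[OF t, of "7 / 2" "?ind A" r] r_conv
      unfolding G_def H_def F_def by (auto intro: summable_sums)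
    have square: "(\<lambda>n. r n * t ^ n) sums F\<^sup>2"
    proof -
      have "summable (\<lambda>n. norm (?ind A n * t ^ n))"
        using sums_summable[OF F] t by (simp add: abs_mult)
      from Cauchy_product_sums[OF this this]
      have "(\<lambda>n. \<Sum>i\<le>n. (?ind A i * t ^ i) * (?ind A (n - i) * t ^ (n - i))) sums F\<^sup>2"
        by (simp only: F_def power2_eq_square)
      moreover have "(\<Sum>i\<le>n. (?ind A i * t ^ i) * (?ind A (n - i) * t ^ (n - i))) = r n * t ^ n" for n
        unfolding r_conv sum_distrib_right
        by (intro sum.cong refl) (simp add: mult_ac flip: power_add)
      ultimately show ?thesis by simp
    qed
    \<comment> \<open>The odd values of the representation function contribute at most \<open>f (t\<^sup>2)\<close>, the value
      of the power series at the smaller point \<open>t\<^sup>2\<close>.\<close>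
    define D where "D = (\<Sum>m. ?ind A m * t ^ (2 * m))"
    have D: "(\<lambda>n. of_bool (even n \<and> n div 2 \<in> A) * t ^ n) sums D" and "D \<le> F"
    proof -
      have le: "?ind A m * t ^ (2 * m) \<le> ?ind A m * t ^ m" for m
        using t by (intro mult_left_mono power_decreasing) auto
      have "summable (\<lambda>m. ?ind A m * t ^ (2 * m))"
        by (rule summable_comparison_test'[OF sums_summable[OF F], of 0]) (use le t in auto)
      then have s: "(\<lambda>m. ?ind A m * t ^ (2 * m)) sums D" by (simp add: D_def summable_sums)
      then show "D \<le> F" using sums_le[OF le s F] by simp
      have "strict_mono (\<lambda>m::nat. 2 * m)" by (simp add: strict_mono_def)
      then have "(\<lambda>m. of_bool (even (2 * m) \<and> 2 * m div 2 \<in> A) * t ^ (2 * m)) sums D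
          \<longleftrightarrow> (\<lambda>n. of_bool (even n \<and> n div 2 \<in> A) * t ^ n) sums D"
        by (rule sums_mono_reindex) (auto elim!: evenE)
      then show "(\<lambda>n. of_bool (even n \<and> n div 2 \<in> A) * t ^ n) sums D" using s by simp
    qed
    have geo: "(\<lambda>n. t ^ n) sums (1 / (1 - t))" using t by (intro geometric_sums) simp
    have pow: "0 \<le> t ^ n" "t ^ n \<le> 1" for n using t by (auto simp: power_le_one)

    \<comment> \<open>The order of growth of \<open>F\<close>; \<open>L\<close> absorbs the finitely many values above 7.\<close>
    have "F\<^sup>2 \<le> 7 * (1 / (1 - t)) + L"
    proof (rule sums_le[OF _ square])
      show "(\<lambda>n. 7 * t ^ n + l n) sums (7 * (1 / (1 - t)) + L)"
        by (intro sums_add sums_mult geo l)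
      show "r n * t ^ n \<le> 7 * t ^ n + l n" for n
      proof (cases "n < N")
        case True
        have "r n * t ^ n \<le> r n" using pow by (simp add: r_def mult_left_le)
        then show ?thesis using True pow[of n] by (simp add: l_def)
      next
        case False
        then have "r n \<le> 7" using r7[of n] by (simp add: r_def)
        then show ?thesis using False pow by (simp add: l_def mult_right_mono)
      qed
    qed
    also have "\<dots> \<le> (7 + L) / (1 - t)"
      using mult_left_mono[of 1 "1 / (1 - t)" L] t L0 by (simp add: add_divide_distrib)
    finally have "F \<le> sqrt ((7 + L) / (1 - t))" by (rule real_le_rsqrt)
    then have "(1 - t) * F \<le> (1 - t) * sqrt ((7 + L) / (1 - t))"
      using t by (intro mult_left_mono) auto
    also have "\<dots> = sqrt (7 + L) * sqrt (1 - t)"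
    proof -
      have "w * w * (s / w) = s * w" if "w > 0" for s w :: real
        using that by simp
      from this[of "sqrt (1 - t)" "sqrt (7 + L)"] show ?thesis
        using t by (simp add: real_sqrt_divide)
    qed
    finally have F_bound: "(1 - t) * F \<le> sqrt (7 + L) * sqrt (1 - t)" .

    have "G \<le> F\<^sup>2 + 1 / 4 * (1 / (1 - t)) + 12 * SE - 4 * S4 + 6 * D + K"
    proof (rule sums_le[OF _ deviation(1)])
      show "(\<lambda>n. r n * t ^ n + 1 / 4 * t ^ n + 12 * (?ind ({1..} - (A + A)) n * t ^ n)
          - 4 * (?ind (rep_level A 4) n * t ^ n)
          + 6 * (of_bool (even n \<and> n div 2 \<in> A) * t ^ n) + k n)
          sums (F\<^sup>2 + 1 / 4 * (1 / (1 - t)) + 12 * SE - 4 * S4 + 6 * D + K)"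
        unfolding SE_def S4_def by (intro sums_add sums_diff sums_mult square geo ind_sums D k)
      fix n
      let ?w = "r n + 1 / 4 + 12 * ?ind ({1..} - (A + A)) n - 4 * ?ind (rep_level A 4) n
          + 6 * of_bool (even n \<and> n div 2 \<in> A)"
      have "(r n - 7 / 2)\<^sup>2 * t ^ n \<le> ?w * t ^ n + k n"
      proof (cases "n < N")
        case True
        have "(r n - 7 / 2)\<^sup>2 * t ^ n \<le> (r n - 7 / 2)\<^sup>2" using pow by (simp add: mult_left_le)
        \<comment> \<open>For small \<open>n\<close>, \<open>?w\<close> may be as low as \<open>- 4\<close>, whence the summand 4 in \<open>k\<close>.\<close>
        moreover have "(- 4) * t ^ n \<le> ?w * t ^ n"
          using pow by (intro mult_right_mono) (auto simp: r_def)
        moreover have "- 4 \<le> (- 4) * t ^ n" using pow[of n] by simp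
        ultimately show ?thesis using True by (simp add: k_def)
      next
        case False
        then have n: "n \<ge> N" "n \<ge> 1" using N by auto
        have "of_bool (odd (rep_count A n)) \<le> (of_bool (even n \<and> n div 2 \<in> A) :: real)"
          using odd_rep_count_imp_double[of A n] by auto
        moreover have "?ind ({1..} - (A + A)) n = of_bool (rep_count A n = 0)"
          "?ind (rep_level A 4) n = of_bool (rep_count A n = 4)"
          using rep_count_pos_iff[of A n] n(2) by (auto simp: rep_level_def)
        ultimately have "(r n - 7 / 2)\<^sup>2 \<le> ?w"
          using deviation_minus_count_le[OF r7[OF n(1)]] unfolding r_def by linarith
        then show ?thesis using False pow by (simp add: k_def mult_right_mono)
      qed
      then show "(r n - 7 / 2)\<^sup>2 * t ^ n
          \<le> r n * t ^ n + 1 / 4 * t ^ n + 12 * (?ind ({1..} - (A + A)) n * t ^ n)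
          - 4 * (?ind (rep_level A 4) n * t ^ n)
          + 6 * (of_bool (even n \<and> n div 2 \<in> A) * t ^ n) + k n"
        by (simp add: algebra_simps)
    qed
    with deviation(2) \<open>D \<le> F\<close>
    have "4 * S4 \<le> 1 / 4 * (1 / (1 - t)) + 12 * SE + K + F * (6 + 7 * H)"
      by (simp add: algebra_simps)
    then have "(1 - t) * (4 * S4) \<le> (1 - t) * (1 / 4 * (1 / (1 - t)) + 12 * SE + K + F * (6 + 7 * H))"
      using t by (intro mult_left_mono) auto
    also have "\<dots> = 1 / 4 + 12 * ((1 - t) * SE) + K * (1 - t) + ((1 - t) * F) * (6 + 7 * H)"
    proof -
      have "u * (1 / 4 * (1 / u) + v + K + F * w) = 1 / 4 + u * v + K * u + (u * F) * w"
        if "u \<noteq> 0" for u v w :: real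
        using that by (simp add: field_simps)
      from this[of "1 - t" "12 * SE" "6 + 7 * H"] show ?thesis using t by simp
    qed
    finally have "4 * ((1 - t) * S4) \<le> 1 / 4 + 12 * ((1 - t) * SE) + K * (1 - t) + ((1 - t) * F) * (6 + 7 * H)"
      by (simp add: mult_ac)
    moreover have "((1 - t) * F) * (6 + 7 * H) \<le> (sqrt (7 + L) * sqrt (1 - t)) * (6 + 7 * H)"
      using F_bound H by (intro mult_right_mono) auto
    moreover have "p \<le> 1 / 16 + 3 * q + (v + w) / 4"
      if "4 * p \<le> 1 / 4 + 12 * q + v + y" "y \<le> w" for p q v w y :: real
      using that by (simp add: field_simps)
    ultimately show ?thesis unfolding S4_def SE_def H_def by blast
  qed
  then show ?thesis by (rule that)
qed

theorem theorem3:
  fixes A E :: "nat set"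
  assumes "A \<subseteq> {1..}"
    and "E = {1..} - (A + A)"
    and "lower_abel_density (rep_level A 4) > ereal (1 / 16) + 3 * upper_density E"
  shows "limsup (\<lambda>n. ereal (real (rep_count A n))) > 7"
proof (rule ccontr)
  assume "\<not> ?thesis"
  then have "limsup (\<lambda>n. ereal (real (rep_count A n))) < ereal 8"
    by (simp add: not_less order.strict_trans1)
  then have "eventually (\<lambda>n. ereal (real (rep_count A n)) < ereal 8) sequentially"
    by (rule Limsup_lessD)
  then have "eventually (\<lambda>n. rep_count A n < 8) sequentially" by simp
  then obtain N where N: "\<And>n. n \<ge> N \<Longrightarrow> rep_count A n < 8"
    by (auto simp: eventually_sequentially)
  have r7: "rep_count A n \<le> 7" if "n \<ge> Suc N" for n
    using N[of n] that by simp
  define S where "S = (\<lambda>B t. \<Sum>n. of_bool (n \<in> B) * t ^ n :: real)"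
  obtain K M where KM: "\<And>t. 0 < t \<Longrightarrow> t < 1 \<Longrightarrow>
      (1 - t) * S (rep_level A 4) t \<le> 1 / 16 + 3 * ((1 - t) * S E t)
        + (K * (1 - t) + M * sqrt (1 - t) * (6 + 7 * (1 - ln (1 - t)))) / 4"
    using abel_level_inequality[OF _ r7] unfolding S_def assms(2) by blast
  obtain d where d: "upper_density E = ereal d"
    using upper_density_bounds[of E] by (cases "upper_density E") auto
  obtain x where x: "ereal (1 / 16) + 3 * upper_density E < ereal x"
    "ereal x < lower_abel_density (rep_level A 4)"
    using ereal_dense2[OF assms(3)] by auto
  have "3 * ereal d = ereal (3 * d)" by (metis numeral_eq_ereal times_ereal.simps(1))
  then have x_gt: "1 / 16 + 3 * d < x" using x(1) by (simp add: d)
  \<comment> \<open>A density bound halfway between \<open>d\<close> and the largest value compatible with \<open>x\<close>.\<close>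
  define d' where "d' = (d + (x - 1 / 16) / 3) / 2"
  have d': "d < d'" "1 / 16 + 3 * d' < x" using x_gt by (simp_all add: d'_def field_simps)
  obtain N' where N': "\<And>t. 0 < t \<Longrightarrow> t < 1 \<Longrightarrow> (1 - t) * S E t \<le> d' + N' * (1 - t)"
    using abel_mean_le_upper_density[of E d'] d d'(1) assms(2) unfolding S_def by auto
  define u where "u = (\<lambda>t. 1 / 16 + 3 * (d' + N' * (1 - t))
      + (K * (1 - t) + M * sqrt (1 - t) * (6 + 7 * (1 - ln (1 - t)))) / 4)"
  have "(u \<longlongrightarrow> 1 / 16 + 3 * (d' + N' * (1 - 1)) + 0) (at_left 1)"
    unfolding u_def by (intro tendsto_intros error_tendsto_0)
  then have "eventually (\<lambda>t. u t < x) (at_left 1)"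
    using d'(2) by (intro order_tendstoD(2)) auto
  moreover have "eventually (\<lambda>t. ereal x < ereal ((1 - t) * set_series (rep_level A 4) t)) (at_left 1)"
    using x(2) unfolding lower_abel_density_def by (rule less_LiminfD)
  moreover have "eventually (\<lambda>t. 0 < t \<and> t < 1) (at_left (1::real))"
    using eventually_at_left_real[of 0 "1::real"] by simp
  ultimately have "eventually (\<lambda>t. False) (at_left (1::real))"
  proof eventually_elim
    case (elim t)
    then have t: "0 < t" "t < 1" by auto
    have "(1 - t) * S (rep_level A 4) t \<le> u t"
      unfolding u_def
      by (rule order_trans[OF KM[OF t]], intro add_right_mono add_left_mono mult_left_mono N'[OF t])
        simp
    with elim show False by (simp add: set_series_eq_suminf S_def)
  qed
  then show False by simp
qed

end
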